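(* Let $T$ be a set with a ternary operation $\langle -,-,-\rangle$, a binary operation $\bullet$ and a bijective map $\alpha:T\to T$. Then $(T,\langle -,-,-\rangle,\bullet,\alpha,\alpha)$ is an $\alpha$-Hom-truss of type $(1)$ if and only if it is an $\alpha$-Hom-truss of type $(2)$.
   Context: An abelian Hom-heap $(T,\langle -,-,-\rangle,\alpha)$ is a set $T$ with a bijective map $\alpha:T\to T$ and a ternary operation such that for all $e,f,x,y,z\in T$: $\langle x,x,y\rangle=\alpha(y)=\langle y,x,x\rangle$; $\langle \alpha(e),\alpha(f),\langle x,y,z\rangle\rangle=\langle\langle e,f,x\rangle,\alpha(y),\alpha(z)\rangle$; $\alpha\langle x,y,z\rangle=\langle\alpha(x),\alpha(y),\alpha(z)\rangle$; and (abelian) $\langle x,y,z\rangle=\langle z,y,x\rangle$. Consider a tuple $(T,\langle -,-,-\rangle,\bullet,\alpha,\beta)$ with a ternary operation, a binary operation and two bijective maps $\alpha,\beta:T\to T$ such that: $(T,\langle -,-,-\rangle,\alpha)$ is an abelian Hom-heap; $\beta\langle a,b,c\rangle=\langle\beta(a),\beta(b),\beta(c)\rangle$ and $\alpha\circ\beta=\beta\circ\alpha$; and $\alpha(a\bullet b)=\alpha(a)\bullet\alpha(b)$, $\beta(a\bullet b)=\beta(a)\bullet\beta(b)$ (for all $a,b,c\in T$). It is a Hom-truss of type $(1)$ if in addition, for all $a,b,c,d\in T$: $\beta(a)\bullet(b\bullet c)=(a\bullet b)\bullet\beta(c)$; $\alpha(a)\bullet\langle b,c,d\rangle=\langle a\bullet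 b,a\bullet c,a\bullet d\rangle$; $\langle a,b,c\rangle\bullet\alpha(d)=\langle a\bullet d,b\bullet d,c\bullet d\rangle$. It is a Hom-truss of type $(2)$ if in addition, for all $a,b,c,d\in T$: $\beta(\alpha^{2}(a))\bullet(\beta(\alpha(b))\bullet\beta^{2}(c))=(\alpha^{2}(a)\bullet\beta(\alpha(b)))\bullet\beta^{2}(\alpha(c))$; $\alpha^{2}(a)\bullet\beta\langle b,c,d\rangle=\langle\alpha(a)\bullet\beta(b),\alpha(a)\bullet\beta(c),\alpha(a)\bullet\beta(d)\rangle$; $\alpha\langle a,b,c\rangle\bullet\alpha(\beta(d))=\langle\alpha(a)\bullet\beta(d),\alpha(b)\bullet\beta(d),\alpha(c)\bullet\beta(d)\rangle$. An $\alpha$-Hom-truss of type $(1)$ (resp. $(2)$) is a Hom-truss of type $(1)$ (resp. $(2)$) with $\alpha=\beta$. *)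

theory Defs
  imports Main
begin

text \<open>
  The underlying set is an explicit carrier \<open>T\<close>, possibly empty.  The operations are HOL functions on
  the ambient type that are required to be closed on \<open>T\<close>; their values outside \<open>T\<close> are irrelevant.
\<close>

locale abelian_hom_heap =
  fixes T :: "'a set"
    and heap :: "'a \<Rightarrow> 'a \<Rightarrow> 'a \<Rightarrow> 'a"  (\<open>\<langle>_,/ _,/ _\<rangle>\<close>)
    and \<alpha> :: "'a \<Rightarrow> 'a"
  assumes bij_alpha: "bij_betw \<alpha> T T"
    and heap_closed: "\<lbrakk>x \<in> T; y \<in> T; z \<in> T\<rbrakk> \<Longrightarrow> \<langle>x, y, z\<rangle> \<in> T"
    and heap_left: "\<lbrakk>x \<in> T; y \<in> T\<rbrakk> \<Longrightarrow> \<langle>x, x, y\<rangle> = \<alpha> y"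
    and heap_right: "\<lbrakk>x \<in> T; y \<in> T\<rbrakk> \<Longrightarrow> \<langle>y, x, x\<rangle> = \<alpha> y"
    and heap_hom_assoc: "\<lbrakk>e \<in> T; f \<in> T; x \<in> T; y \<in> T; z \<in> T\<rbrakk>
          \<Longrightarrow> \<langle>\<alpha> e, \<alpha> f, \<langle>x, y, z\<rangle>\<rangle> = \<langle>\<langle>e, f, x\<rangle>, \<alpha> y, \<alpha> z\<rangle>"
    and alpha_heap: "\<lbrakk>x \<in> T; y \<in> T; z \<in> T\<rbrakk> \<Longrightarrow> \<alpha> \<langle>x, y, z\<rangle> = \<langle>\<alpha> x, \<alpha> y, \<alpha> z\<rangle>"
    and heap_abelian: "\<lbrakk>x \<in> T; y \<in> T; z \<in> T\<rbrakk> \<Longrightarrow> \<langle>x, y, z\<rangle> = \<langle>z, y, x\<rangle>"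

locale hom_truss_base = abelian_hom_heap T heap \<alpha>
  for T :: "'a set"
    and heap :: "'a \<Rightarrow> 'a \<Rightarrow> 'a \<Rightarrow> 'a"  (\<open>\<langle>_,/ _,/ _\<rangle>\<close>)
    and mult :: "'a \<Rightarrow> 'a \<Rightarrow> 'a"  (infixl \<open>\<bullet>\<close> 70)
    and \<alpha> \<beta> :: "'a \<Rightarrow> 'a" +
  assumes bij_beta: "bij_betw \<beta> T T"
    and mult_closed: "\<lbrakk>a \<in> T; b \<in> T\<rbrakk> \<Longrightarrow> a \<bullet> b \<in> T"
    and beta_heap: "\<lbrakk>a \<in> T; b \<in> T; c \<in> T\<rbrakk> \<Longrightarrow> \<beta> \<langle>a, b, c\<rangle> = \<langle>\<beta> a, \<beta> b, \<beta> c\<rangle>"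
    and alpha_beta_commute: "a \<in> T \<Longrightarrow> \<alpha> (\<beta> a) = \<beta> (\<alpha> a)"
    and alpha_mult: "\<lbrakk>a \<in> T; b \<in> T\<rbrakk> \<Longrightarrow> \<alpha> (a \<bullet> b) = \<alpha> a \<bullet> \<alpha> b"
    and beta_mult: "\<lbrakk>a \<in> T; b \<in> T\<rbrakk> \<Longrightarrow> \<beta> (a \<bullet> b) = \<beta> a \<bullet> \<beta> b"

locale hom_truss_type1 = hom_truss_base T heap mult \<alpha> \<beta>
  for T :: "'a set"
    and heap :: "'a \<Rightarrow> 'a \<Rightarrow> 'a \<Rightarrow> 'a"  (\<open>\<langle>_,/ _,/ _\<rangle>\<close>)
    and mult :: "'a \<Rightarrow> 'a \<Rightarrow> 'a"  (infixl \<open>\<bullet>\<close> 70)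
    and \<alpha> \<beta> :: "'a \<Rightarrow> 'a" +
  assumes assoc1: "\<lbrakk>a \<in> T; b \<in> T; c \<in> T\<rbrakk> \<Longrightarrow> \<beta> a \<bullet> (b \<bullet> c) = (a \<bullet> b) \<bullet> \<beta> c"
    and distrib_left1: "\<lbrakk>a \<in> T; b \<in> T; c \<in> T; d \<in> T\<rbrakk>
          \<Longrightarrow> \<alpha> a \<bullet> \<langle>b, c, d\<rangle> = \<langle>a \<bullet> b, a \<bullet> c, a \<bullet> d\<rangle>"
    and distrib_right1: "\<lbrakk>a \<in> T; b \<in> T; c \<in> T; d \<in> T\<rbrakk>
          \<Longrightarrow> \<langle>a, b, c\<rangle> \<bullet> \<alpha> d = \<langle>a \<bullet> d, b \<bullet> d, c \<bullet> d\<rangle>"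

locale hom_truss_type2 = hom_truss_base T heap mult \<alpha> \<beta>
  for T :: "'a set"
    and heap :: "'a \<Rightarrow> 'a \<Rightarrow> 'a \<Rightarrow> 'a"  (\<open>\<langle>_,/ _,/ _\<rangle>\<close>)
    and mult :: "'a \<Rightarrow> 'a \<Rightarrow> 'a"  (infixl \<open>\<bullet>\<close> 70)
    and \<alpha> \<beta> :: "'a \<Rightarrow> 'a" +
  assumes assoc2: "\<lbrakk>a \<in> T; b \<in> T; c \<in> T\<rbrakk>
          \<Longrightarrow> \<beta> ((\<alpha> ^^ 2) a) \<bullet> (\<beta> (\<alpha> b) \<bullet> (\<beta> ^^ 2) c)
            = ((\<alpha> ^^ 2) a \<bullet> \<beta> (\<alpha> b)) \<bullet> (\<beta> ^^ 2) (\<alpha> c)"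
    and distrib_left2: "\<lbrakk>a \<in> T; b \<in> T; c \<in> T; d \<in> T\<rbrakk>
          \<Longrightarrow> (\<alpha> ^^ 2) a \<bullet> \<beta> \<langle>b, c, d\<rangle> = \<langle>\<alpha> a \<bullet> \<beta> b, \<alpha> a \<bullet> \<beta> c, \<alpha> a \<bullet> \<beta> d\<rangle>"
    and distrib_right2: "\<lbrakk>a \<in> T; b \<in> T; c \<in> T; d \<in> T\<rbrakk>
          \<Longrightarrow> \<alpha> \<langle>a, b, c\<rangle> \<bullet> \<alpha> (\<beta> d) = \<langle>\<alpha> a \<bullet> \<beta> d, \<alpha> b \<bullet> \<beta> d, \<alpha> c \<bullet> \<beta> d\<rangle>"

text \<open>As maps \<open>T \<rightarrow> T\<close>, \<open>\<alpha>\<close> and \<open>\<beta>\<close> are equal when they agree on \<open>T\<close>.\<close>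

definition alpha_hom_truss_type1 ::
    "'a set \<Rightarrow> ('a \<Rightarrow> 'a \<Rightarrow> 'a \<Rightarrow> 'a) \<Rightarrow> ('a \<Rightarrow> 'a \<Rightarrow> 'a) \<Rightarrow> ('a \<Rightarrow> 'a) \<Rightarrow> ('a \<Rightarrow> 'a) \<Rightarrow> bool"
  where "alpha_hom_truss_type1 T heap mult \<alpha> \<beta> \<longleftrightarrow>
    hom_truss_type1 T heap mult \<alpha> \<beta> \<and> (\<forall>x\<in>T. \<alpha> x = \<beta> x)"

definition alpha_hom_truss_type2 ::
    "'a set \<Rightarrow> ('a \<Rightarrow> 'a \<Rightarrow> 'a \<Rightarrow> 'a) \<Rightarrow> ('a \<Rightarrow> 'a \<Rightarrow> 'a) \<Rightarrow> ('a \<Rightarrow> 'a) \<Rightarrow> ('a \<Rightarrow> 'a) \<Rightarrow> bool"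
  where "alpha_hom_truss_type2 T heap mult \<alpha> \<beta> \<longleftrightarrow>
    hom_truss_type2 T heap mult \<alpha> \<beta> \<and> (\<forall>x\<in>T. \<alpha> x = \<beta> x)"

end

theory Submission
  imports Defs
begin

text \<open>
  For \<open>\<beta> = \<alpha>\<close>, multiplicativity turns each axiom of type 2 into the corresponding axiom of type 1
  evaluated at elements of the image of \<open>\<alpha>\<close> or \<open>\<alpha>\<^sup>2\<close>; as \<open>\<alpha>\<close> is onto, nothing is lost.
\<close>

lemma (in abelian_hom_heap) alpha_closed: "x \<in> T \<Longrightarrow> \<alpha> x \<in> T"
  using bij_alpha by (rule bij_betwE [THEN bspec])

lemma (in abelian_hom_heap) alpha_surj:
  assumes "x \<in> T"
  obtains y where "y \<in> T" "x = \<alpha> y"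
  using assms bij_alpha by (auto simp: bij_betw_def)

text \<open>Pure instantiation: associativity of type 2 is \<open>assoc1\<close> at the
  \<alpha>^2-images of \<open>a\<close>, \<open>b\<close>, \<open>c\<close>. Once
  \<open>alpha_heap\<close> moves \<alpha> inside the bracket, the distributive laws are those of
  type 1 at \<alpha>-images.\<close>

lemma hom_truss_type1_imp_type2:
  assumes "hom_truss_type1 T heap mult \<alpha> \<alpha>"
  shows "hom_truss_type2 T heap mult \<alpha> \<alpha>"
proof -
  interpret hom_truss_type1 T heap mult \<alpha> \<alpha> by fact
  show ?thesis
    by unfold_locales
      (simp_all add: numeral_2_eq_2 alpha_closed alpha_heap assoc1 distrib_left1 distrib_right1)
qed

lemma hom_truss_type2_imp_type1:
  assumes "hom_truss_type2 T heap mult \<alpha> \<alpha>"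
  shows "hom_truss_type1 T heap mult \<alpha> \<alpha>"
proof -
  interpret hom_truss_type2 T heap mult \<alpha> \<alpha> by fact
  show ?thesis
  proof unfold_locales
    fix a b c assume "a \<in> T" "b \<in> T" "c \<in> T"
    \<comment> \<open>Preimages under \<alpha>^2, since \<open>assoc2\<close> at \<beta> = \<alpha>
      has each variable under at least two copies of \<alpha>.\<close>
    then obtain a' b' c' where "a' \<in> T" "b' \<in> T" "c' \<in> T"
        and "a = \<alpha> (\<alpha> a')" "b = \<alpha> (\<alpha> b')" "c = \<alpha> (\<alpha> c')"
      by (metis alpha_surj)
    then show "mult (\<alpha> a) (mult b c) = mult (mult a b) (\<alpha> c)"
      using assoc2 [of a' b' c'] by (simp add: numeral_2_eq_2)
  next
    fix a b c d assume "a \<in> T" "b \<in> T" "c \<in> T" "d \<in> T"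
    \<comment> \<open>Here single preimages suffice: after \<open>alpha_heap\<close>, each variable
      of the distributive laws stands under one \<alpha>, and the outer multiplier under
      two.\<close>
    then obtain a' b' c' d' where *: "a' \<in> T" "b' \<in> T" "c' \<in> T" "d' \<in> T"
        "a = \<alpha> a'" "b = \<alpha> b'" "c = \<alpha> c'" "d = \<alpha> d'"
      by (metis alpha_surj)
    show "mult (\<alpha> a) (heap b c d) = heap (mult a b) (mult a c) (mult a d)"
      using distrib_left2 [of a' b' c' d'] * by (simp add: numeral_2_eq_2 alpha_heap)
    show "mult (heap a b c) (\<alpha> d) = heap (mult a d) (mult b d) (mult c d)"
      using distrib_right2 [of a' b' c' d'] * by (simp add: alpha_heap)
  qed
qed

theorem corollary4p15:
  fixes T :: "'a set"
    and heap :: "'a \<Rightarrow> 'a \<Rightarrow> 'a \<Rightarrow> 'a"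
    and mult :: "'a \<Rightarrow> 'a \<Rightarrow> 'a"
    and \<alpha> :: "'a \<Rightarrow> 'a"
  assumes "\<And>x y z. \<lbrakk>x \<in> T; y \<in> T; z \<in> T\<rbrakk> \<Longrightarrow> heap x y z \<in> T"
    and "\<And>x y. \<lbrakk>x \<in> T; y \<in> T\<rbrakk> \<Longrightarrow> mult x y \<in> T"
    and "bij_betw \<alpha> T T"
  shows "alpha_hom_truss_type1 T heap mult \<alpha> \<alpha> \<longleftrightarrow> alpha_hom_truss_type2 T heap mult \<alpha> \<alpha>"
  unfolding alpha_hom_truss_type1_def alpha_hom_truss_type2_def
  using hom_truss_type1_imp_type2 hom_truss_type2_imp_type1 by blast

end
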